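(* Let $1\le d\le\ln N$, let $\mathbf{U}\in\mathbb{R}^{N\times d}$ have rank $d$, let $\epsilon>0$, and let $\mathcal{L}_1=\{\boldsymbol{l}\in[0,1]^N:\boldsymbol{l}=\mathbf{U}\mathbf{v}\text{ for some }\mathbf{v}\in\mathbb{R}^d\}$ and $\mathcal{L}_2=\{\boldsymbol{l}\in[0,1]^N:\|\boldsymbol{l}\|_2^2\le\epsilon\}$. Then for every sequence of loss vectors $\boldsymbol{l}_1,\dots,\boldsymbol{l}_T\in\mathcal{L}=\mathcal{L}_1+\mathcal{L}_2$ (Minkowski sum), Online Mirror Descent with regularizer $R(\mathbf{x})=\mathbf{x}^\top\mathbf{H}\mathbf{x}+\epsilon\|\mathbf{x}\|_2^2$ (on $\Omega=\mathbb{R}^N$) and learning rate $\eta^*=\sqrt{\frac{2(16d+\epsilon)}{T}}$ satisfies $$\mathrm{Regret}_T\le\sqrt{2(16d+\epsilon)T},$$ where $\mathbf{H}=\mathbf{I}_N+\mathbf{U}\mathbf{M}\mathbf{U}^\top$ is the matrix defined in the context.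
   Context: The matrix $\mathbf{H}$: for $\mathbf{U}\in\mathbb{R}^{N\times d}$ of rank $d$, let $K=\{\mathbf{v}\in\mathbb{R}^d:\|\mathbf{U}\mathbf{v}\|_\infty\le1\}$, and let $\mathbf{M}\in\mathbb{R}^{d\times d}$ be the positive definite matrix such that $\{\mathbf{v}\in\mathbb{R}^d:\mathbf{v}^\top\mathbf{M}^{-1}\mathbf{v}\le1\}$ is the Löwner–John ellipsoid (minimum-volume enclosing ellipsoid) of the symmetric convex body $K$. Then $\mathbf{H}=\mathbf{I}_N+\mathbf{U}\mathbf{M}\mathbf{U}^\top$. Notation: $\Delta_N=\{\mathbf{x}\in[0,1]^N:\sum_i x_i=1\}$. Prediction with expert advice: in each round $t=1,\dots,T$ the learner plays $\mathbf{p}_t\in\Delta_N$ (depending on $\boldsymbol{l}_1,\dots,\boldsymbol{l}_{t-1}$), then the loss vector $\boldsymbol{l}_t\in\mathbb{R}^N$ is revealed and the learner suffers $\mathbf{p}_t\cdot\boldsymbol{l}_t$. The regret is $\mathrm{Regret}_T=\sum_{t=1}^T\mathbf{p}_t\cdot\boldsymbol{l}_t-\min_{i\in\{1,\dots,N\}}\sum_{t=1}^T l_t(i)$. Online Mirror Descent with learning rate $\eta>0$, convex set $\Omega\supseteq\Delta_N$ and strictly convex differentiable regularizer $R:\Omega\to\mathbb{R}$: start with $\mathbf{p}_1=\operatorname{argmin}_{\mathbf{p}\in\Delta_N}R(\mathbf{p})$; after observing $\boldsymbol{l}_t$, let $\tilde{\mathbf{p}}_{t+1}\in\Omega$ satisfy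 $\nabla R(\tilde{\mathbf{p}}_{t+1})=\nabla R(\mathbf{p}_t)-\eta\boldsymbol{l}_t$, and set $\mathbf{p}_{t+1}=\operatorname{argmin}_{\mathbf{p}\in\Delta_N}B_R(\mathbf{p},\tilde{\mathbf{p}}_{t+1})$, where $B_R(\mathbf{u},\mathbf{v})=R(\mathbf{u})-R(\mathbf{v})-(\mathbf{u}-\mathbf{v})\cdot\nabla R(\mathbf{v})$. *)

theory Defs
  imports "HOL-Analysis.Analysis"
begin

definition positive_definite :: "real^'n^'n \<Rightarrow> bool" where
  "positive_definite A \<longleftrightarrow> transpose A = A \<and> (\<forall>x. x \<noteq> 0 \<longrightarrow> 0 < x \<bullet> (A *v x))"

definition ellipsoid :: "real^'n \<Rightarrow> real^'n^'n \<Rightarrow> (real^'n) set" where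
  "ellipsoid c A = {v. (v - c) \<bullet> (matrix_inv A *v (v - c)) \<le> 1}"

text \<open>Minimality is required among all ellipsoids containing the set, whatever their centre.\<close>

definition is_lowner_john_ellipsoid :: "(real^'n) set \<Rightarrow> (real^'n) set \<Rightarrow> bool" where
  "is_lowner_john_ellipsoid K E \<longleftrightarrow>
     (\<exists>c A. positive_definite A \<and> E = ellipsoid c A) \<and> K \<subseteq> E \<and>
     (\<forall>c A. positive_definite A \<and> K \<subseteq> ellipsoid c A \<longrightarrow>
        measure lebesgue E \<le> measure lebesgue (ellipsoid c A))"

definition sym_body :: "real^'d^'n \<Rightarrow> (real^'d) set" where
  "sym_body U = {v. infnorm (U *v v) \<le> 1}"

definition prob_simplex :: "(real^'n) set" where
  "prob_simplex = {x. (\<forall>i. 0 \<le> x $ i \<and> x $ i \<le> 1) \<and> (\<Sum>i\<in>UNIV. x $ i) = 1}"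

text \<open>Rounds are numbered from \<open>1\<close>: \<open>p t\<close> and \<open>l t\<close> are the play and the loss in round \<open>t\<close>.\<close>

definition regret :: "(nat \<Rightarrow> real^'n) \<Rightarrow> (nat \<Rightarrow> real^'n) \<Rightarrow> nat \<Rightarrow> real" where
  "regret p l T = (\<Sum>t=1..T. p t \<bullet> l t) - (MIN i. \<Sum>t=1..T. l t $ i)"

text \<open>The derivative is taken within the domain \<open>\<Omega>\<close>, since the regularizer is a function on \<open>\<Omega>\<close> only;
  for \<open>\<Omega> = UNIV\<close> this is the usual gradient.\<close>

definition gradient_within :: "('a::real_inner) set \<Rightarrow> ('a \<Rightarrow> real) \<Rightarrow> 'a \<Rightarrow> 'a" where
  "gradient_within \<Omega> R x = (THE g. (R has_derivative (\<lambda>h. g \<bullet> h)) (at x within \<Omega>))"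

definition bregman :: "('a::real_inner) set \<Rightarrow> ('a \<Rightarrow> real) \<Rightarrow> 'a \<Rightarrow> 'a \<Rightarrow> real" where
  "bregman \<Omega> R u v = R u - R v - (u - v) \<bullet> gradient_within \<Omega> R v"

text \<open>\<open>omd_after \<Omega> R \<eta> l k\<close> is the point held by Online Mirror Descent once \<open>l 1, \<dots>, l k\<close> have been
  observed, so it is the play of round \<open>k + 1\<close>. In the recursion, \<open>q\<close> is the unprojected point.\<close>

primrec omd_after ::
  "(real^'n) set \<Rightarrow> (real^'n \<Rightarrow> real) \<Rightarrow> real \<Rightarrow> (nat \<Rightarrow> real^'n) \<Rightarrow> nat \<Rightarrow> real^'n" where
  "omd_after \<Omega> R \<eta> l 0 = arg_min_on R prob_simplex"
| "omd_after \<Omega> R \<eta> l (Suc k) =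
     (let q = (SOME q. q \<in> \<Omega> \<and>
                 gradient_within \<Omega> R q
                   = gradient_within \<Omega> R (omd_after \<Omega> R \<eta> l k) - \<eta> *\<^sub>R l (Suc k))
      in arg_min_on (\<lambda>p. bregman \<Omega> R p q) prob_simplex)"

definition omd ::
  "(real^'n) set \<Rightarrow> (real^'n \<Rightarrow> real) \<Rightarrow> real \<Rightarrow> (nat \<Rightarrow> real^'n) \<Rightarrow> nat \<Rightarrow> real^'n" where
  "omd \<Omega> R \<eta> l t = omd_after \<Omega> R \<eta> l (t - 1)"

definition subspace_losses :: "real^'d^'n \<Rightarrow> (real^'n) set" where
  "subspace_losses U = {l. (\<forall>i. 0 \<le> l $ i \<and> l $ i \<le> 1) \<and> (\<exists>v. l = U *v v)}"

definition small_losses :: "real \<Rightarrow> (real^'n) set" where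
  "small_losses \<epsilon> = {l. (\<forall>i. 0 \<le> l $ i \<and> l $ i \<le> 1) \<and> (norm l)\<^sup>2 \<le> \<epsilon>}"

definition H_matrix :: "real^'d^'n \<Rightarrow> real^'d^'d \<Rightarrow> real^'n^'n" where
  "H_matrix U M = mat 1 + U ** M ** transpose U"

definition regularizer :: "real^'n^'n \<Rightarrow> real \<Rightarrow> real^'n \<Rightarrow> real" where
  "regularizer H \<epsilon> x = x \<bullet> (H *v x) + \<epsilon> * (norm x)\<^sup>2"

end

theory Submission
  imports Defs
begin

text \<open>
  The regularizer is the quadratic form of \<open>A = (1 + \<epsilon>) I + U M U\<^sup>T\<close>, so Online Mirror Descent is a
  gradient step followed by projection in the \<open>A\<close>-norm. The Pythagorean inequality for the
  projection telescopes to \<open>\<eta> Regret \<le> A\<^bsub>ii\<^esub> + \<eta>\<^sup>2/4 \<Sum> l\<^bsub>t\<^esub>\<^sup>T A\<^sup>-\<^sup>1 l\<^bsub>t\<^esub>\<close>.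
  A loss \<open>U v\<close> has \<open>v\<close> in the body, hence in the ellipsoid of \<open>M\<close>, so by Fenchel duality each of the
  two parts of a loss contributes at most 1 to \<open>l\<^sup>T A\<^sup>-\<^sup>1 l\<close>.

  On the other side, \<open>A\<^bsub>ii\<^esub> \<le> 1 + \<epsilon> + d\<close> is John's theorem in the direction of the row \<open>w\<close> of \<open>U\<close>: the
  body lies in the slab \<open>\<bar>w \<bullet> v\<bar> \<le> 1\<close>, and if \<open>w\<^sup>T M w > d\<close>, then the ellipsoid of
  \<open>(1 - \<mu>) M\<^sup>-\<^sup>1 + \<mu> w w\<^sup>T\<close> for a small \<open>\<mu>\<close> also contains the body and has smaller volume.
\<close>

section \<open>Positive definite matrices and their sublevel sets\<close>

lemma inner_matrix_mult_commute:
  fixes A :: "real^'n^'n"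
  assumes "transpose A = A"
  shows "x \<bullet> (A *v y) = y \<bullet> (A *v x)"
  by (metis assms dot_lmul_matrix inner_commute vector_transpose_matrix)

lemma matrix_inv_inverse:
  fixes A :: "real^'n^'n"
  assumes "invertible A"
  shows "A ** matrix_inv A = mat 1" "matrix_inv A ** A = mat 1"
proof -
  have "A ** matrix_inv A = mat 1 \<and> matrix_inv A ** A = mat 1"
    using assms unfolding invertible_def matrix_inv_def by (rule someI_ex)
  then show "A ** matrix_inv A = mat 1" "matrix_inv A ** A = mat 1" by auto
qed

lemma matrix_inv_eqI:
  fixes A :: "real^'n^'n"
  assumes "A ** B = mat 1"
  shows "matrix_inv A = B"
proof -
  have "invertible A" using assms invertible_right_inverse by blast
  then show ?thesis
    by (metis assms matrix_inv_inverse(2) matrix_mul_assoc matrix_mul_lid matrix_mul_rid)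
qed

lemma positive_definite_invertible:
  fixes A :: "real^'n^'n"
  assumes "positive_definite A"
  shows "invertible A"
proof -
  have "\<forall>x. A *v x = 0 \<longrightarrow> x = 0"
    using assms by (metis inner_zero_right less_irrefl positive_definite_def)
  then show ?thesis
    by (simp add: invertible_left_inverse matrix_left_invertible_ker)
qed

lemma positive_definite_matrix_inv:
  fixes A :: "real^'n^'n"
  assumes "positive_definite A"
  shows "positive_definite (matrix_inv A)"
proof -
  note inv = matrix_inv_inverse[OF positive_definite_invertible[OF assms]]
  have sym: "transpose A = A" using assms by (simp add: positive_definite_def)
  have "A ** transpose (matrix_inv A) = mat 1"
    by (metis inv(2) matrix_transpose_mul sym transpose_mat)
  then have "transpose (matrix_inv A) = matrix_inv A"
    using matrix_inv_eqI by metis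
  moreover have "0 < x \<bullet> (matrix_inv A *v x)" if "x \<noteq> 0" for x
  proof -
    \<comment> \<open>Substituting \<open>x = A *v y\<close> turns the form of the inverse into the
      form of \<open>A\<close>.\<close>
    define y where "y = matrix_inv A *v x"
    have x: "x = A *v y" by (simp add: y_def matrix_vector_mul_assoc inv)
    then have "y \<noteq> 0" using that by auto
    then have "0 < y \<bullet> (A *v y)" using assms by (simp add: positive_definite_def)
    then show ?thesis by (metis x y_def inner_commute)
  qed
  ultimately show ?thesis by (simp add: positive_definite_def)
qed

lemma matrix_inv_matrix_inv:
  fixes A :: "real^'n^'n"
  assumes "invertible A"
  shows "matrix_inv (matrix_inv A) = A"
  by (rule matrix_inv_eqI) (rule matrix_inv_inverse(2)[OF assms])

lemma positive_definite_nonneg: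
  assumes "positive_definite A"
  shows "0 \<le> x \<bullet> (A *v x)"
  using assms unfolding positive_definite_def
  by (cases "x = 0") (auto intro: less_imp_le)

text \<open>On the compact unit sphere the form attains a positive minimum, which serves as
  \<open>c\<close>; homogeneity of degree two extends the bound to all \<open>x\<close>.\<close>

lemma positive_definite_coercive:
  fixes A :: "real^'n^'n"
  assumes "positive_definite A"
  obtains c where "0 < c" "\<And>x. c * (norm x)\<^sup>2 \<le> x \<bullet> (A *v x)"
proof -
  have "continuous_on (sphere 0 1) (\<lambda>x::real^'n. x \<bullet> (A *v x))"
    by (intro continuous_intros linear_continuous_on) auto
  moreover have "sphere (0::real^'n) 1 \<noteq> {}" by simp
  ultimately obtain z where z: "z \<in> sphere 0 1"
    and min: "\<And>x. x \<in> sphere 0 1 \<Longrightarrow> z \<bullet> (A *v z) \<le> x \<bullet> (A *v x)"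
    using continuous_attains_inf[OF compact_sphere] by blast
  have "0 < z \<bullet> (A *v z)"
    using z assms unfolding positive_definite_def by (metis norm_zero mem_sphere_0 zero_neq_one)
  moreover have "z \<bullet> (A *v z) * (norm x)\<^sup>2 \<le> x \<bullet> (A *v x)" for x
  proof (cases "x = 0")
    case False
    define s where "s = inverse (norm x) *\<^sub>R x"
    have "s \<in> sphere 0 1" using False by (simp add: s_def)
    then have "z \<bullet> (A *v z) \<le> s \<bullet> (A *v s)" by (rule min)
    also have "\<dots> = (x \<bullet> (A *v x)) / (norm x)\<^sup>2"
      by (simp add: s_def matrix_vector_mult_scaleR power2_eq_square field_simps)
    finally show ?thesis using False by (simp add: field_simps)
  qed auto
  ultimately show ?thesis using that by blast
qed

text \<open>Coercivity bounds the sublevel set, and the strict sublevel set is an open neighbourhood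
  of 0 inside it. The positive volume is cancelled in a later comparison.\<close>

lemma
  fixes A :: "real^'n^'n"
  assumes "positive_definite A"
  shows compact_quadratic_sublevel: "compact {x. x \<bullet> (A *v x) \<le> 1}" (is "compact ?E")
    and measure_quadratic_sublevel_pos: "0 < measure lebesgue {x. x \<bullet> (A *v x) \<le> 1}"
proof -
  have cont: "continuous_on UNIV (\<lambda>x::real^'n. x \<bullet> (A *v x))"
    by (intro continuous_intros linear_continuous_on) auto
  obtain c where c: "0 < c" "\<And>x. c * (norm x)\<^sup>2 \<le> x \<bullet> (A *v x)"
    using positive_definite_coercive[OF assms] by blast
  have "norm x \<le> sqrt (1 / c)" if "x \<in> ?E" for x
  proof (rule real_le_rsqrt)
    have "c * (norm x)\<^sup>2 \<le> 1" using c(2)[of x] that by auto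
    then show "(norm x)\<^sup>2 \<le> 1 / c" using c(1) by (simp add: field_simps)
  qed
  then have "bounded ?E" by (auto simp: bounded_iff)
  moreover have "closed ?E" by (intro closed_Collect_le cont continuous_on_const)
  ultimately show comp: "compact ?E" by (simp add: compact_eq_bounded_closed)
  have "open {x. x \<bullet> (A *v x) < 1}" by (intro open_Collect_less cont continuous_on_const)
  moreover have "0 \<in> {x. x \<bullet> (A *v x) < 1}" by simp
  ultimately have "\<not> negligible {x. x \<bullet> (A *v x) < 1}"
    using open_not_negligible by blast
  moreover have "{x. x \<bullet> (A *v x) < 1} \<subseteq> ?E" by auto
  ultimately have "\<not> negligible ?E" using negligible_subset by blast
  then show "0 < measure lebesgue ?E"
    using lmeasurable_compact[OF comp] by (simp add: negligible_iff_measure0 zero_less_measure_iff)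
qed

section \<open>Determinants of rank-one updates\<close>

definition outer :: "real^'n \<Rightarrow> real^'m \<Rightarrow> real^'m^'n" where
  "outer u w = (\<chi> i j. u $ i * w $ j)"

lemma outer_mult_vector: "outer u w *v x = (w \<bullet> x) *\<^sub>R u"
  by (simp add: outer_def vec_eq_iff matrix_vector_mult_def inner_vec_def sum_distrib_left
      mult_ac)

text \<open>If \<open>w $ k \<noteq> 0\<close>, conjugation with the matrix \<open>Q\<close> that replaces the \<open>k\<close>-th coordinate of \<open>x\<close>
  by \<open>w \<bullet> x\<close> turns the rank-one update into the change of a single column.\<close>

lemma det_mat_1_plus_outer:
  fixes u w :: "real^'n"
  shows "det (mat 1 + outer u w) = 1 + w \<bullet> u"
proof (cases "w = 0")
  case True
  then have "mat 1 + outer u w = mat 1" by (simp add: outer_def vec_eq_iff)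
  then show ?thesis using True by simp
next
  case False
  then obtain k where k: "w $ k \<noteq> 0" by (auto simp: vec_eq_iff)
  define Q :: "real^'n^'n" where "Q = (\<chi> i j. if i = k then w $ j else mat 1 $ i $ j)"
  \<comment> \<open>\<open>N\<close> is the identity with column \<open>k\<close> replaced by
    \<open>axis k 1 + Q *v u\<close>. Keeping the product with \<open>mat 1\<close> makes the
    definition an instance of \<open>cramer_lemma\<close>.\<close>
  define N :: "real^'n^'n" where
    "N = (\<chi> i j. if j = k then (mat 1 *v (axis k 1 + Q *v u)) $ i else mat 1 $ i $ j)"
  have Qv: "Q *v x = (\<chi> i. if i = k then w \<bullet> x else x $ i)" for x
    by (simp add: Q_def vec_eq_iff matrix_vector_mult_def inner_vec_def mat_def if_distrib
        [of "\<lambda>a. a * _"] cong: if_cong)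
  have N: "N = (\<chi> i j. if j = k then (axis k 1 + Q *v u) $ i else mat 1 $ i $ j)"
    by (simp only: N_def matrix_vector_mul_lid)
  have Nv: "N *v y = y + y $ k *\<^sub>R (Q *v u)" for y
  proof -
    have "(N *v y) $ i = (y + y $ k *\<^sub>R (Q *v u)) $ i" for i
    proof -
      have "(N *v y) $ i = (\<Sum>j\<in>UNIV. (if j = i then y $ j else 0)
              + (if j = k then (Q *v u) $ i * y $ j else 0))"
        unfolding N matrix_vector_mult_def[of "vec_lambda _"]
        by (auto intro!: sum.cong simp: mat_def axis_def algebra_simps)
      then show ?thesis by (simp add: sum.distrib)
    qed
    then show ?thesis by (simp add: vec_eq_iff)
  qed
  have "Q ** (mat 1 + outer u w) = N ** Q"
  proof -
    have "(Q ** (mat 1 + outer u w)) *v x = (N ** Q) *v x" for x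
    proof -
      \<comment> \<open>Coordinate \<open>k\<close> of \<open>Q *v x\<close> is
        \<open>w \<bullet> x\<close>, the coefficient with which both sides add
        \<open>Q *v u\<close>.\<close>
      have "Q *v (x + (w \<bullet> x) *\<^sub>R u) = Q *v x + (Q *v x) $ k *\<^sub>R (Q *v u)"
        by (simp add: matrix_vector_right_distrib matrix_vector_mult_scaleR Qv)
      then show ?thesis
        by (simp add: matrix_vector_mul_assoc[symmetric] matrix_vector_mult_add_rdistrib
            outer_mult_vector Nv)
    qed
    then show ?thesis by (simp add: matrix_eq)
  qed
  then have "det Q * det (mat 1 + outer u w) = det N * det Q"
    by (metis det_mul)
  moreover have "det Q = w $ k"
  proof -
    have "transpose Q = (\<chi> i j. if j = k then (mat 1 *v w) $ i else mat 1 $ i $ j)"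
      unfolding matrix_vector_mul_lid
      by (auto simp: Q_def transpose_def vec_eq_iff mat_def)
    then have "det (transpose Q) = w $ k * det (mat 1 :: real^'n^'n)"
      by (simp only: cramer_lemma)
    then show ?thesis by (simp add: det_transpose)
  qed
  moreover have "det N = 1 + w \<bullet> u"
    unfolding N_def cramer_lemma by (simp add: Qv axis_def)
  ultimately show ?thesis using k by simp
qed

lemma det_scaleR:
  fixes A :: "real^'n^'n"
  shows "det (c *\<^sub>R A) = c ^ CARD('n) * det A"
proof -
  have "c *\<^sub>R A = (\<chi> i. c *s (A $ i))" by (simp add: vec_eq_iff)
  moreover have "(\<chi> i. A $ i) = A" by (simp add: vec_eq_iff)
  ultimately show ?thesis using det_rows_mul[of "\<lambda>_. c" "\<lambda>i. A $ i"] by simp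
qed

section \<open>Volumes of images under rank-one updates\<close>

text \<open>The library computes the volume of a linear image only for well-ordered index types. The type
  \<open>'a ranked\<close> is a well-ordered copy of the finite type \<open>'a\<close>, from which the formula is transported.\<close>

typedef 'a ranked = "{..<CARD('a::finite)}"
  by (rule exI[of _ 0]) simp

lemma card_ranked: "CARD('a::finite ranked) = CARD('a)"
  by (simp add: type_definition.card[OF type_definition_ranked])

instance ranked :: (finite) finite
proof
  show "finite (UNIV :: 'a ranked set)"
    using type_definition.univ[OF type_definition_ranked] by (metis finite_imageI finite_lessThan)
qed

instantiation ranked :: (finite) linorder
begin

definition less_eq_ranked :: "'a ranked \<Rightarrow> 'a ranked \<Rightarrow> bool" where
  "x \<le> y \<longleftrightarrow> Rep_ranked x \<le> Rep_ranked y"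

definition less_ranked :: "'a ranked \<Rightarrow> 'a ranked \<Rightarrow> bool" where
  "x < y \<longleftrightarrow> Rep_ranked x < Rep_ranked y"

instance
  by standard (auto simp: less_eq_ranked_def less_ranked_def Rep_ranked_inject)

end

instance ranked :: (finite) wellorder
proof
  fix P :: "'a ranked \<Rightarrow> bool" and a
  assume step: "\<And>x. (\<And>y. y < x \<Longrightarrow> P y) \<Longrightarrow> P x"
  show "P a"
  proof (induction a rule: measure_induct_rule[of Rep_ranked])
    case (less x)
    show ?case by (rule step, rule less) (simp add: less_ranked_def)
  qed
qed

text \<open>Precomposition with \<open>h\<close>, hence contravariant: a map from \<open>'m\<close>
  to \<open>'n\<close> carries vectors indexed by \<open>'n\<close> to vectors indexed by
  \<open>'m\<close>.\<close>

definition relabel :: "('m \<Rightarrow> 'n) \<Rightarrow> real^'n \<Rightarrow> real^'m" where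
  "relabel h x = (\<chi> i. x $ h i)"

lemma relabel_nth [simp]: "relabel h x $ i = x $ h i"
  by (simp add: relabel_def)

lemma relabel_add: "relabel h (x + y) = relabel h x + relabel h y"
  and relabel_scaleR: "relabel h (c *\<^sub>R x) = c *\<^sub>R relabel h x"
  by (simp_all add: vec_eq_iff)

lemma linear_relabel: "linear (relabel h)"
  by (intro linearI relabel_add relabel_scaleR)

lemma inner_relabel:
  assumes "bij h"
  shows "relabel h x \<bullet> relabel h y = x \<bullet> y"
  using sum.reindex_bij_betw[of h UNIV UNIV "\<lambda>i. x $ i * y $ i"] assms
  by (simp add: inner_vec_def)

lemma relabel_inv:
  assumes "bij h"
  shows "relabel h (relabel (inv h) x) = x" "relabel (inv h) (relabel h y) = y"
  using assms by (simp_all add: vec_eq_iff bij_is_inj bij_is_surj surj_f_inv_f)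

lemma prod_Basis_cart: "(\<Prod>b\<in>Basis. x \<bullet> b) = (\<Prod>i\<in>UNIV. x $ i)" for x :: "real^'n"
proof -
  have inj: "inj (\<lambda>i::'n. axis i (1::real))" by (simp add: inj_on_def axis_eq_axis)
  have "(Basis :: (real^'n) set) = range (\<lambda>i. axis i 1)" by (auto simp: Basis_vec_def)
  then have "(\<Prod>b\<in>Basis. x \<bullet> b) = (\<Prod>b\<in>range (\<lambda>i. axis i 1). x \<bullet> b)"
    by (rule arg_cong)
  also have "\<dots> = (\<Prod>i\<in>UNIV. x \<bullet> axis i 1)" by (simp only: prod.reindex[OF inj] o_def)
  finally show ?thesis by (simp add: inner_axis)
qed

text \<open>Lebesgue measure is determined by its values on boxes, and the preimage of a box is a
  box with the same side lengths in another order.\<close>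

lemma lborel_distr_relabel:
  fixes h :: "'m::finite \<Rightarrow> 'n::finite"
  assumes "bij h"
  shows "distr lborel borel (relabel h) = lborel"
proof (rule lborel_eqI[symmetric])
  have [measurable]: "relabel h \<in> borel_measurable borel"
    by (intro borel_measurable_continuous_onI linear_continuous_on)
      (simp add: linear_conv_bounded_linear[symmetric] linear_relabel)
  fix l u :: "real^'m"
  assume "\<And>b. b \<in> Basis \<Longrightarrow> l \<bullet> b \<le> u \<bullet> b"
  then have le: "l $ i \<le> u $ i" for i
    by (metis Basis_real_def axis_in_Basis_iff inner_axis insertI1 real_inner_1_right)
  let ?l = "relabel (inv h) l" and ?u = "relabel (inv h) u"
  have "relabel h -` box l u = box ?l ?u"
  proof -
    have "(\<forall>i. l $ i < x $ h i \<and> x $ h i < u $ i)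
        \<longleftrightarrow> (\<forall>j. l $ inv h j < x $ j \<and> x $ j < u $ inv h j)" for x
      using assms by (metis bij_inv_eq_iff)
    then show ?thesis by (auto simp: mem_box_cart)
  qed
  then have "emeasure (distr lborel borel (relabel h)) (box l u) = emeasure lborel (box ?l ?u)"
    by (simp add: emeasure_distr)
  also have "\<dots> = (\<Prod>b\<in>Basis. (?u - ?l) \<bullet> b)"
    using le by (intro emeasure_lborel_box) (auto simp: Basis_vec_def inner_axis)
  also have "(\<Prod>b\<in>Basis. (?u - ?l) \<bullet> b) = (\<Prod>b\<in>Basis. (u - l) \<bullet> b)"
    using prod.reindex_bij_betw[OF bij_imp_bij_inv[OF assms], of "\<lambda>i. u $ i - l $ i"]
    by (simp add: prod_Basis_cart)
  finally show "emeasure (distr lborel borel (relabel h)) (box l u) = (\<Prod>b\<in>Basis. (u - l) \<bullet> b)" .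
qed simp

text \<open>The image under \<open>relabel h\<close> is the preimage under
  \<open>relabel (inv h)\<close>, which pushes \<open>lborel\<close> forward to
  \<open>lborel\<close>. Compactness makes both sets Borel.\<close>

lemma measure_relabel_image:
  fixes h :: "'m::finite \<Rightarrow> 'n::finite"
  assumes h: "bij h" and "compact S"
  shows "measure lebesgue (relabel h ` S) = measure lebesgue S"
proof -
  have S: "S \<in> sets borel" using \<open>compact S\<close> by (simp add: borel_compact)
  have "bounded_linear (relabel h)" "bounded_linear (relabel (inv h))"
    by (simp_all add: linear_conv_bounded_linear[symmetric] linear_relabel)
  then have "compact (relabel h ` S)" and meas: "relabel (inv h) \<in> borel_measurable lborel"
    using \<open>compact S\<close>
    by (auto intro!: compact_continuous_image linear_continuous_on borel_measurable_continuous_onI)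
  then have "measure lebesgue (relabel h ` S) = measure lborel (relabel h ` S)"
    by (simp add: borel_compact)
  also have "\<dots> = measure lborel (relabel (inv h) -` S)"
    using relabel_inv[OF h]
    by (intro arg_cong[of _ _ "measure lborel"]) (auto simp: image_iff, metis)
  also have "\<dots> = measure (distr lborel borel (relabel (inv h))) S"
    using measure_distr[OF meas S] by simp
  also have "\<dots> = measure lebesgue S"
    using S by (simp add: lborel_distr_relabel[OF bij_imp_bij_inv[OF h]])
  finally show ?thesis .
qed

text \<open>Relabelling along a bijection from \<open>'n ranked\<close> preserves volumes and inner
  products, and it conjugates the map to the matrix \<open>S\<close>, whose determinant is
  known.\<close>

lemma measure_rank_one_update_image:
  fixes u w :: "real^'n"
  assumes "compact K"
  shows "measure lebesgue ((\<lambda>x. c *\<^sub>R (x + (w \<bullet> x) *\<^sub>R u)) ` K)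
    = \<bar>c ^ CARD('n) * (1 + w \<bullet> u)\<bar> * measure lebesgue K" (is "measure _ (?T ` K) = _")
proof -
  obtain h :: "'n ranked \<Rightarrow> 'n" where h: "bij h"
    using finite_same_card_bij[of "UNIV :: 'n ranked set" "UNIV :: 'n set"]
    by (auto simp: card_ranked)
  let ?f = "relabel h"
  define S where "S = c *\<^sub>R (mat 1 + outer (?f u) (?f w))"
  have "S *v (?f x) = ?f (?T x)" for x
    by (simp add: S_def scaleR_matrix_vector_assoc[symmetric] matrix_vector_mult_add_rdistrib
        outer_mult_vector inner_relabel[OF h] relabel_add relabel_scaleR)
  then have image: "(*v) S ` ?f ` K = ?f ` ?T ` K" by (simp add: image_image)
  have "bounded_linear ?f"
    by (simp add: linear_conv_bounded_linear[symmetric] linear_relabel)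
  then have fK: "compact (?f ` K)"
    using assms by (auto intro!: compact_continuous_image linear_continuous_on)
  have TK: "compact (?T ` K)"
    by (intro compact_continuous_image assms continuous_intros)
  have "measure lebesgue (?T ` K) = measure lebesgue ((*v) S ` ?f ` K)"
    by (simp add: image measure_relabel_image[OF h TK])
  also have "\<dots> = \<bar>det S\<bar> * measure lebesgue (?f ` K)"
    using measure_linear_image[of "(*v) S" "?f ` K"] lmeasurable_compact[OF fK] by simp
  also have "det S = c ^ CARD('n) * (1 + w \<bullet> u)"
    by (simp add: S_def det_scaleR det_mat_1_plus_outer inner_relabel[OF h] card_ranked)
  finally show ?thesis by (simp add: measure_relabel_image[OF h assms])
qed

section \<open>Width of the Loewner-John ellipsoid\<close>

text \<open>The competing ellipsoid is mapped into the given one by a linear map of determinant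
  greater than 1, so the volume of an ellipsoid never has to be computed.\<close>

lemma lowner_john_width:
  fixes M :: "real^'d^'d"
  assumes M: "positive_definite M"
    and LJ: "is_lowner_john_ellipsoid K {v. v \<bullet> (matrix_inv M *v v) \<le> 1}"
    and w: "\<And>v. v \<in> K \<Longrightarrow> \<bar>w \<bullet> v\<bar> \<le> 1"
  shows "w \<bullet> (M *v w) \<le> real CARD('d)"
proof (rule ccontr)
  define P where "P = matrix_inv M"
  define s where "s = w \<bullet> (M *v w)"
  define d where "d = real CARD('d)"
  assume "\<not> w \<bullet> (M *v w) \<le> real CARD('d)"
  then have sd: "d < s" by (simp add: s_def d_def)
  have d1: "1 \<le> d" by (simp add: d_def Suc_leI)
  have P: "positive_definite P" unfolding P_def by (rule positive_definite_matrix_inv[OF M])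
  have PM: "P ** M = mat 1" "M ** P = mat 1"
    unfolding P_def using matrix_inv_inverse[OF positive_definite_invertible[OF M]] by auto
  text \<open>To first order in \<open>\<mu>\<close>, the determinant of the matrix \<open>B\<close> below exceeds that of \<open>P\<close> by the
    factor \<open>1 + \<mu> * (s - d)\<close>, so every sufficiently small \<open>\<mu>\<close> would do.\<close>
  define \<mu> where "\<mu> = (s - d) / (2 * d * s)"
  have \<mu>: "0 < \<mu>" "\<mu> < 1"
  proof -
    have "s \<le> d * s" using d1 sd by (simp add: mult_le_cancel_right1)
    then have "s - d < 2 * d * s" using d1 sd by linarith
    then show "0 < \<mu>" "\<mu> < 1" using sd d1 by (auto simp: \<mu>_def)
  qed
  \<comment> \<open>On \<open>K\<close> both \<open>x \<bullet> (P *v x)\<close> and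
    \<open>(w \<bullet> x)\<^sup>2\<close> are at most 1, hence so is their convex
    combination.\<close>
  define B where "B = (1 - \<mu>) *\<^sub>R P + \<mu> *\<^sub>R outer w w"
  have Bv: "B *v x = (1 - \<mu>) *\<^sub>R (P *v x) + (\<mu> * (w \<bullet> x)) *\<^sub>R w" for x
    by (simp add: B_def matrix_vector_mult_add_rdistrib scaleR_matrix_vector_assoc[symmetric]
        outer_mult_vector)
  have Bq: "x \<bullet> (B *v x) = (1 - \<mu>) * (x \<bullet> (P *v x)) + \<mu> * (w \<bullet> x)\<^sup>2" for x
    by (simp add: Bv inner_add_right power2_eq_square inner_commute)
  have "positive_definite B"
    unfolding positive_definite_def
  proof (intro conjI allI impI)
    have "transpose P = P" using P by (simp add: positive_definite_def)
    then show "transpose B = B"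
      by (simp add: B_def outer_def transpose_def vec_eq_iff mult.commute)
    fix x :: "real^'d"
    assume "x \<noteq> 0"
    then have "0 < x \<bullet> (P *v x)" using P by (simp add: positive_definite_def)
    then have "0 < (1 - \<mu>) * (x \<bullet> (P *v x))" using \<mu> by simp
    then show "0 < x \<bullet> (B *v x)" using \<mu> by (simp add: Bq add_pos_nonneg)
  qed
  note B = this
  have ell: "ellipsoid 0 (matrix_inv B) = {x. x \<bullet> (B *v x) \<le> 1}"
    by (simp add: ellipsoid_def matrix_inv_matrix_inv[OF positive_definite_invertible[OF B]])
  have "K \<subseteq> ellipsoid 0 (matrix_inv B)"
  proof
    fix x assume x: "x \<in> K"
    then have "x \<bullet> (P *v x) \<le> 1" using LJ by (auto simp: is_lowner_john_ellipsoid_def P_def)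
    moreover have "(w \<bullet> x)\<^sup>2 \<le> 1" using w[OF x] by (simp add: abs_square_le_1)
    ultimately have "(1 - \<mu>) * (x \<bullet> (P *v x)) + \<mu> * (w \<bullet> x)\<^sup>2 \<le> (1 - \<mu>) * 1 + \<mu> * 1"
      using \<mu> by (intro add_mono mult_left_mono) auto
    then show "x \<in> ellipsoid 0 (matrix_inv B)" by (simp add: ell Bq)
  qed
  then have le: "measure lebesgue {x. x \<bullet> (P *v x) \<le> 1}
      \<le> measure lebesgue {x. x \<bullet> (B *v x) \<le> 1}"
    using LJ positive_definite_matrix_inv[OF B]
    unfolding is_lowner_john_ellipsoid_def P_def ell[symmetric] by blast
  text \<open>The parameters \<open>\<tau>\<close>, \<open>\<beta>\<close> and \<open>r\<close> are chosen so that the map \<open>S\<close> pulls the quadratic form of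
    \<open>P\<close> back to that of \<open>B\<close>; its determinant is \<open>D\<close>.\<close>
  define \<tau> where "\<tau> = sqrt (1 + s * \<mu> / (1 - \<mu>))"
  have s0: "0 < s" using sd d1 by simp
  have \<tau>2: "\<tau>\<^sup>2 = 1 + s * \<mu> / (1 - \<mu>)" using s0 \<mu> by (simp add: \<tau>_def)
  have \<tau>0: "0 < \<tau>" using s0 \<mu> by (simp add: \<tau>_def add_pos_nonneg)
  define \<beta> r where "\<beta> = (\<tau> - 1) / s" and "r = sqrt (1 - \<mu>)"
  have r: "0 < r" "r\<^sup>2 = 1 - \<mu>" using \<mu> by (auto simp: r_def)
  define S where "S x = r *\<^sub>R (x + (w \<bullet> x) *\<^sub>R (\<beta> *\<^sub>R (M *v w)))" for x
  define D where "D = r ^ CARD('d) * \<tau>"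
  have D0: "0 < D" using r(1) \<tau>0 by (simp add: D_def)
  have "D\<^sup>2 = (r\<^sup>2) ^ CARD('d) * \<tau>\<^sup>2"
    by (simp add: D_def power_mult_distrib power_mult[symmetric] mult.commute)
  also have "\<dots> = (1 - \<mu>) ^ CARD('d) * (1 + s * \<mu> / (1 - \<mu>))" by (simp add: r(2) \<tau>2)
  \<comment> \<open>One of the factors \<open>1 - \<mu>\<close> is absorbed into the last
    factor.\<close>
  also have "\<dots> = (1 - \<mu>) ^ (CARD('d) - 1) * (1 + \<mu> * (s - 1))"
  proof -
    obtain m where "CARD('d) = Suc m" using not0_implies_Suc[of "CARD('d)"] by auto
    then show ?thesis using \<mu> by (simp add: field_simps)
  qed
  finally have D2: "D\<^sup>2 = (1 - \<mu>) ^ (CARD('d) - 1) * (1 + \<mu> * (s - 1))" .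
  have "1 < (1 - \<mu> * (d - 1)) * (1 + \<mu> * (s - 1))"
  proof -
    \<comment> \<open>The second-order loss is at most half of the first-order gain
      \<open>\<mu> * (s - d)\<close>; the denominator \<open>2 * d * s\<close> of
      \<open>\<mu>\<close> is chosen for this.\<close>
    have "\<mu> * ((d - 1) * (s - 1)) \<le> \<mu> * (d * s)"
      using \<mu> sd d1 by (intro mult_left_mono mult_mono) auto
    also have "\<dots> = (s - d) / 2" using d1 s0 by (simp add: \<mu>_def)
    also have "\<dots> < s - d" using sd by simp
    finally have "0 < \<mu> * ((s - d) - \<mu> * ((d - 1) * (s - 1)))" using \<mu> by simp
    then show ?thesis by (simp add: algebra_simps)
  qed
  also have "\<dots> \<le> D\<^sup>2"
    unfolding D2
  proof (rule mult_right_mono)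
    show "1 - \<mu> * (d - 1) \<le> (1 - \<mu>) ^ (CARD('d) - 1)"
      using Bernoulli_inequality[of "- \<mu>" "CARD('d) - 1"] \<mu>
      by (simp add: d_def of_nat_diff Suc_leI mult.commute)
    show "0 \<le> 1 + \<mu> * (s - 1)" using \<mu> sd d1 by simp
  qed
  finally have "1 < D\<^sup>2" .
  then have D1: "1 < D" using power2_less_imp_less[of 1 D] D0 by simp
  have PMv: "P *v (M *v v) = v" for v by (simp add: matrix_vector_mul_assoc PM)
  have Sq: "S x \<bullet> (P *v S x) = x \<bullet> (B *v x)" for x
  proof -
    have cross: "(M *v w) \<bullet> (P *v x) = w \<bullet> x"
      using P inner_matrix_mult_commute[of P "M *v w" x]
      by (simp add: positive_definite_def PMv inner_commute)
    have "S x \<bullet> (P *v S x)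
        = r\<^sup>2 * (x \<bullet> (P *v x) + (2 * \<beta> + \<beta>\<^sup>2 * s) * (w \<bullet> x)\<^sup>2)"
      by (simp add: S_def matrix_vector_mult_scaleR matrix_vector_right_distrib PMv cross
          inner_add_left inner_add_right s_def inner_commute[of _ w]
          power2_eq_square algebra_simps)
    \<comment> \<open>The left side is \<open>((1 + \<beta> * s)\<^sup>2 - 1) / s\<close>, and
      \<open>1 + \<beta> * s = \<tau>\<close>.\<close>
    also have "2 * \<beta> + \<beta>\<^sup>2 * s = (\<tau>\<^sup>2 - 1) / s"
      using s0 by (simp add: \<beta>_def power2_eq_square field_simps)
    also have "\<dots> = \<mu> / (1 - \<mu>)" using s0 by (simp add: \<tau>2)
    finally show ?thesis using \<mu> by (simp add: Bq r(2) distrib_left)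
  qed
  let ?EB = "{x. x \<bullet> (B *v x) \<le> 1}"
  \<comment> \<open>The image of \<open>?EB\<close> lies in the ellipsoid of \<open>P\<close>, whose
    volume is at most that of \<open>?EB\<close> by \<open>le\<close>. With \<open>1 < D\<close>
    this is contradictory.\<close>
  have "D * measure lebesgue ?EB = measure lebesgue (S ` ?EB)"
  proof -
    have "1 + w \<bullet> (\<beta> *\<^sub>R (M *v w)) = \<tau>" using s0 by (simp add: \<beta>_def s_def[symmetric])
    then show ?thesis
      using D0 measure_rank_one_update_image[OF compact_quadratic_sublevel[OF B],
          of r w "\<beta> *\<^sub>R (M *v w)"]
      unfolding S_def[abs_def] D_def by simp
  qed
  also have "\<dots> \<le> measure lebesgue {x. x \<bullet> (P *v x) \<le> 1}"
  proof (rule measure_mono_fmeasurable)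
    show "{x. x \<bullet> (P *v x) \<le> 1} \<in> lmeasurable"
      by (intro lmeasurable_compact compact_quadratic_sublevel P)
    have "compact (S ` ?EB)"
      unfolding S_def
      by (intro compact_continuous_image continuous_intros compact_quadratic_sublevel B)
    then show "S ` ?EB \<in> sets lebesgue" using lmeasurable_compact by blast
  qed (auto simp: Sq)
  also note le
  finally have "D * measure lebesgue ?EB \<le> 1 * measure lebesgue ?EB" by simp
  then show False
    using D1 measure_quadratic_sublevel_pos[OF B] by simp
qed

section \<open>Minimisers and projections in a quadratic norm\<close>

text \<open>\<open>arg_min_on\<close> is a choice operator, so it is known to minimise once some
  minimiser exists.\<close>

lemma arg_min_on_attained:
  fixes f :: "'a \<Rightarrow> 'b::linorder"
  assumes "\<exists>x\<in>S. \<forall>y\<in>S. f x \<le> f y"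
  shows "arg_min_on f S \<in> S" "\<And>y. y \<in> S \<Longrightarrow> f (arg_min_on f S) \<le> f y"
proof -
  have "\<exists>x. is_arg_min f (\<lambda>x. x \<in> S) x"
    using assms unfolding is_arg_min_linorder by blast
  then have "is_arg_min f (\<lambda>x. x \<in> S) (arg_min_on f S)"
    unfolding arg_min_on_def arg_min_def by (rule someI_ex)
  then show "arg_min_on f S \<in> S" "\<And>y. y \<in> S \<Longrightarrow> f (arg_min_on f S) \<le> f y"
    by (auto simp: is_arg_min_linorder)
qed

text \<open>At the minimiser the derivative towards \<open>u\<close>, which is \<open>2 * b\<close>,
  cannot be negative; expanding the form at \<open>t = 1\<close> then gives the claim.\<close>

lemma quadratic_minimizer_pythagoras:
  fixes A :: "real^'n^'n"
  assumes sym: "transpose A = A" and "convex S" "p \<in> S" "u \<in> S"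
    and min: "\<And>x. x \<in> S \<Longrightarrow> (p - q) \<bullet> (A *v (p - q)) \<le> (x - q) \<bullet> (A *v (x - q))"
  shows "(p - q) \<bullet> (A *v (p - q)) + (u - p) \<bullet> (A *v (u - p)) \<le> (u - q) \<bullet> (A *v (u - q))"
proof -
  define b c where "b = (u - p) \<bullet> (A *v (p - q))" and "c = (u - p) \<bullet> (A *v (u - p))"
  have expand: "(p + t *\<^sub>R (u - p) - q) \<bullet> (A *v (p + t *\<^sub>R (u - p) - q))
      = (p - q) \<bullet> (A *v (p - q)) + 2 * t * b + t\<^sup>2 * c" for t
  proof -
    have *: "p + t *\<^sub>R (u - p) - q = (p - q) + t *\<^sub>R (u - p)" by simp
    show ?thesis
      unfolding * matrix_vector_right_distrib matrix_vector_mult_scaleR inner_add_left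
        inner_add_right inner_scaleR_left inner_scaleR_right
        inner_matrix_mult_commute[OF sym, of "p - q" "u - p"] b_def c_def
      by (simp add: power2_eq_square algebra_simps)
  qed
  \<comment> \<open>The increment along the segment is nonnegative and is divided by
    \<open>t\<close>; letting \<open>t\<close> tend to 0 leaves
    \<open>0 \<le> 2 * b\<close>.\<close>
  have pos: "0 \<le> 2 * b + t * c" if "0 < t" "t \<le> 1" for t
  proof -
    have "p + t *\<^sub>R (u - p) \<in> S"
      using convexD_alt[OF \<open>convex S\<close> \<open>p \<in> S\<close> \<open>u \<in> S\<close>, of t] that
      by (simp add: algebra_simps)
    then have "0 \<le> 2 * t * b + t\<^sup>2 * c" using min expand[of t] by fastforce
    then have "0 \<le> t * (2 * b + t * c)" by (simp add: power2_eq_square algebra_simps)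
    then show ?thesis using that by (simp add: zero_le_mult_iff)
  qed
  have "((\<lambda>t. 2 * b + t * c) \<longlongrightarrow> 2 * b + 0 * c) (at_right 0)"
    by (intro tendsto_intros)
  moreover have "\<forall>\<^sub>F t in at_right (0::real). 0 \<le> 2 * b + t * c"
    by (rule eventually_at_rightI[of 0 1]) (use pos in auto)
  ultimately have "0 \<le> 2 * b + 0 * c" by (rule tendsto_lowerbound) simp
  then show ?thesis using expand[of 1] by (simp add: c_def)
qed

section \<open>The probability simplex\<close>

text \<open>A box cut by a hyperplane, a form from which compactness and convexity are
  immediate.\<close>

lemma prob_simplex_eq: "prob_simplex = cbox 0 1 \<inter> {x::real^'n. 1 \<bullet> x = 1}"
  by (auto simp: prob_simplex_def mem_box_cart inner_vec_def)

lemma compact_prob_simplex: "compact (prob_simplex :: (real^'n) set)"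
  by (simp add: prob_simplex_eq compact_Int_closed compact_cbox closed_hyperplane)

lemma convex_prob_simplex: "convex (prob_simplex :: (real^'n) set)"
  unfolding prob_simplex_eq by (intro convex_Int convex_box(1) convex_hyperplane)

lemma axis_in_prob_simplex: "axis i 1 \<in> (prob_simplex :: (real^'n) set)"
  by (auto simp: prob_simplex_def axis_def)

lemma prob_simplex_attains_min:
  fixes f :: "real^'n \<Rightarrow> real"
  assumes "continuous_on UNIV f"
  shows "\<exists>x\<in>prob_simplex. \<forall>y\<in>prob_simplex. f x \<le> f y"
  using assms axis_in_prob_simplex
  by (intro continuous_attains_inf compact_prob_simplex) (auto intro: continuous_on_subset)

section \<open>Online Mirror Descent with a quadratic regularizer\<close>

lemma continuous_on_quadratic:
  fixes A :: "real^'n^'n"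
  shows "continuous_on S (\<lambda>x. (x - q) \<bullet> (A *v (x - q)))"
  by (intro continuous_intros linear_continuous_on_compose[of _ _ "(*v) A"]) auto

text \<open>Symmetry merges the two terms of the product rule, and uniqueness of derivatives
  resolves the \<open>THE\<close> in the definition.\<close>

lemma gradient_within_quadratic:
  fixes A :: "real^'n^'n"
  assumes sym: "transpose A = A"
  shows "gradient_within UNIV (\<lambda>x. x \<bullet> (A *v x)) x = 2 *\<^sub>R (A *v x)"
  unfolding gradient_within_def
proof (rule the_equality)
  have "((\<lambda>x. x \<bullet> (A *v x)) has_derivative (\<lambda>h. x \<bullet> (A *v h) + h \<bullet> (A *v x))) (at x)"
    by (intro derivative_intros bounded_linear_imp_has_derivative) auto
  moreover have "x \<bullet> (A *v h) + h \<bullet> (A *v x) = 2 *\<^sub>R (A *v x) \<bullet> h" for h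
    using inner_matrix_mult_commute[OF sym, of x h] by (simp add: inner_commute[of h])
  ultimately show deriv: "((\<lambda>x. x \<bullet> (A *v x)) has_derivative (\<lambda>h. 2 *\<^sub>R (A *v x) \<bullet> h)) (at x)"
    by simp
  fix g
  assume "((\<lambda>x. x \<bullet> (A *v x)) has_derivative (\<lambda>h. g \<bullet> h)) (at x)"
  from has_derivative_unique[OF this deriv] show "g = 2 *\<^sub>R (A *v x)"
    by (metis vector_eq_rdot)
qed

text \<open>A quadratic equals its second-order Taylor expansion, so the divergence is the squared
  distance in the \<open>A\<close>-norm.\<close>

lemma bregman_quadratic:
  fixes A :: "real^'n^'n"
  assumes sym: "transpose A = A"
  shows "bregman UNIV (\<lambda>x. x \<bullet> (A *v x)) u v = (u - v) \<bullet> (A *v (u - v))"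
  unfolding bregman_def gradient_within_quadratic[OF sym]
  by (simp add: matrix_vector_mult_diff_distrib inner_diff_left inner_diff_right
      inner_matrix_mult_commute[OF sym, of v u])

text \<open>Projecting \<open>q\<close> does not increase the \<open>A\<close>-distance to
  \<open>u\<close>, and expanding the distance from \<open>q\<close> produces the linear loss and
  the dual norm term.\<close>

lemma omd_quadratic_step:
  fixes A :: "real^'n^'n" and l :: "nat \<Rightarrow> real^'n" and \<eta> :: real
  assumes A: "positive_definite A" and "u \<in> prob_simplex"
  defines "p \<equiv> omd_after UNIV (\<lambda>x. x \<bullet> (A *v x)) \<eta> l"
  shows "\<eta> * ((p k - u) \<bullet> l (Suc k)) + (u - p (Suc k)) \<bullet> (A *v (u - p (Suc k)))
    \<le> (u - p k) \<bullet> (A *v (u - p k)) + \<eta>\<^sup>2 / 4 * (l (Suc k) \<bullet> (matrix_inv A *v l (Suc k)))"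
proof -
  have sym: "transpose A = A" using A by (simp add: positive_definite_def)
  note inv = matrix_inv_inverse[OF positive_definite_invertible[OF A]]
  define z where "z = matrix_inv A *v l (Suc k)"
  have Az: "A *v z = l (Suc k)" by (simp add: z_def matrix_vector_mul_assoc inv)
  \<comment> \<open>The factor 1/2 cancels the 2 in the gradient
    \<open>2 *\<^sub>R (A *v x)\<close>.\<close>
  define q where "q = p k - (\<eta> / 2) *\<^sub>R z"
  let ?D = "\<lambda>x. (x - q) \<bullet> (A *v (x - q))"
  \<comment> \<open>Invertibility of \<open>A\<close> makes the unprojected point unique, so the
    \<open>SOME\<close> in \<open>omd_after\<close> selects \<open>q\<close>.\<close>
  have dual_step: "2 *\<^sub>R (A *v q') = 2 *\<^sub>R (A *v p k) - \<eta> *\<^sub>R l (Suc k) \<longleftrightarrow> q' = q" for q'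
  proof -
    have "2 *\<^sub>R (A *v p k) - \<eta> *\<^sub>R l (Suc k) = 2 *\<^sub>R (A *v q)"
      by (simp add: q_def matrix_vector_mult_diff_distrib matrix_vector_mult_scaleR Az
          scaleR_diff_right)
    moreover have "A *v q' = A *v q \<longleftrightarrow> q' = q"
      by (metis inv(2) matrix_vector_mul_assoc matrix_vector_mul_lid)
    ultimately show ?thesis by simp
  qed
  have p: "p (Suc k) = arg_min_on ?D prob_simplex"
    using dual_step unfolding p_def
    by (simp add: gradient_within_quadratic[OF sym] bregman_quadratic[OF sym])
  note min = arg_min_on_attained[OF prob_simplex_attains_min
      [OF continuous_on_quadratic[of _ q A]], folded p]
  have "(u - p (Suc k)) \<bullet> (A *v (u - p (Suc k))) \<le> ?D u"
    using quadratic_minimizer_pythagoras[OF sym convex_prob_simplex min(1) assms(2) min(2)]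
      positive_definite_nonneg[OF A, of "p (Suc k) - q"] by linarith
  also have "?D u = (u - p k) \<bullet> (A *v (u - p k)) + \<eta> * ((u - p k) \<bullet> l (Suc k))
      + \<eta>\<^sup>2 / 4 * (l (Suc k) \<bullet> z)"
  proof -
    have *: "u - q = (u - p k) + (\<eta> / 2) *\<^sub>R z" by (simp add: q_def)
    show ?thesis
      unfolding * matrix_vector_right_distrib matrix_vector_mult_scaleR inner_add_left
        inner_add_right inner_scaleR_left inner_scaleR_right
        inner_matrix_mult_commute[OF sym, of z "u - p k"] Az
      by (simp add: power2_eq_square inner_commute algebra_simps)
  qed
  finally show ?thesis by (simp add: z_def inner_diff_left algebra_simps)
qed

text \<open>The squared distances to \<open>u\<close> telescope over the rounds, and the last one is
  nonnegative.\<close>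

lemma omd_quadratic_regret:
  fixes A :: "real^'n^'n"
  assumes A: "positive_definite A" and u: "u \<in> prob_simplex"
  shows "\<eta> * (\<Sum>t=1..T. (omd UNIV (\<lambda>x. x \<bullet> (A *v x)) \<eta> l t - u) \<bullet> l t)
    \<le> u \<bullet> (A *v u) + \<eta>\<^sup>2 / 4 * (\<Sum>t=1..T. l t \<bullet> (matrix_inv A *v l t))"
proof -
  define p where "p = omd_after UNIV (\<lambda>x. x \<bullet> (A *v x)) \<eta> l"
  let ?D = "\<lambda>x. (u - x) \<bullet> (A *v (u - x))"
  have sym: "transpose A = A" using A by (simp add: positive_definite_def)
  \<comment> \<open>The first play is the projection of 0, so the Pythagorean inequality also bounds
    the initial distance.\<close>
  have p0: "p 0 = arg_min_on (\<lambda>x. (x - 0) \<bullet> (A *v (x - 0))) prob_simplex"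
    by (simp add: p_def)
  note min = arg_min_on_attained[OF prob_simplex_attains_min
      [OF continuous_on_quadratic[of _ 0 A]], folded p0]
  have "?D (p 0) \<le> u \<bullet> (A *v u)"
    using quadratic_minimizer_pythagoras[OF sym convex_prob_simplex min(1) u min(2)]
      positive_definite_nonneg[OF A, of "p 0"] by simp
  moreover have "\<eta> * (\<Sum>t=1..T. (omd UNIV (\<lambda>x. x \<bullet> (A *v x)) \<eta> l t - u) \<bullet> l t) + ?D (p T)
      \<le> ?D (p 0) + \<eta>\<^sup>2 / 4 * (\<Sum>t=1..T. l t \<bullet> (matrix_inv A *v l t))"
  proof (induction T)
    \<comment> \<open>The play of round \<open>Suc T\<close> is \<open>p T\<close>, since
      \<open>omd\<close> shifts the index by one.\<close>
    case (Suc T)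
    then show ?case
      using omd_quadratic_step[OF A u, of \<eta> l T]
      by (simp add: omd_def p_def[symmetric] distrib_left)
  qed simp
  ultimately show ?thesis using positive_definite_nonneg[OF A, of "u - p T"] by linarith
qed

text \<open>Some expert attains the minimum, and its cumulative loss is that of always playing the
  vertex \<open>axis i 1\<close>.\<close>

lemma regret_le:
  fixes p l :: "nat \<Rightarrow> real^'n"
  assumes "\<And>i. (\<Sum>t=1..T. (p t - axis i 1) \<bullet> l t) \<le> b"
  shows "regret p l T \<le> b"
proof -
  have "(MIN i. \<Sum>t=1..T. l t $ i) \<in> range (\<lambda>i. \<Sum>t=1..T. l t $ i)"
    by (intro Min_in) simp_all
  then obtain i where i: "(MIN i. \<Sum>t=1..T. l t $ i) = (\<Sum>t=1..T. l t $ i)"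
    by (rule rangeE)
  show ?thesis
    using assms[of i] unfolding regret_def i
    by (simp add: inner_diff_left sum_subtractf inner_axis')
qed

section \<open>Dual norm estimates and the regret bound\<close>

text \<open>The form of \<open>M\<close> is nonnegative at \<open>y - matrix_inv M *v v\<close>;
  expanding it there gives the inequality.\<close>

lemma quadratic_Fenchel_le:
  assumes "positive_definite M"
  shows "2 * (y \<bullet> v) \<le> y \<bullet> (M *v y) + v \<bullet> (matrix_inv M *v v)"
proof -
  define P where "P = matrix_inv M"
  note inv = matrix_inv_inverse[OF positive_definite_invertible[OF assms]]
  have sym: "transpose M = M" using assms by (simp add: positive_definite_def)
  have MP: "M *v (P *v v) = v" by (simp add: P_def matrix_vector_mul_assoc inv)
  have "0 \<le> (y - P *v v) \<bullet> (M *v (y - P *v v))" by (rule positive_definite_nonneg[OF assms])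
  also have "\<dots> = y \<bullet> (M *v y) - 2 * (y \<bullet> v) + v \<bullet> (P *v v)"
    using inner_matrix_mult_commute[OF sym, of "P *v v" y]
    by (simp add: matrix_vector_mult_diff_distrib inner_diff_left inner_diff_right MP
        inner_commute[of v])
  finally show ?thesis by (simp add: P_def)
qed

text \<open>The summands are later paired with the two kinds of loss: the norm with the small part,
  the \<open>M\<close>-term with the subspace part.\<close>

lemma H_matrix_quadratic:
  "x \<bullet> (H_matrix U M *v x) = (norm x)\<^sup>2 + (transpose U *v x) \<bullet> (M *v (transpose U *v x))"
proof -
  have "x \<bullet> (U *v y) = (transpose U *v x) \<bullet> y" for y by (simp add: dot_lmul_matrix)
  then show ?thesis
    by (simp add: H_matrix_def matrix_vector_mult_add_rdistrib matrix_vector_mul_assoc[symmetric]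
        inner_add_right power2_norm_eq_inner del: transpose_matrix_vector)
qed

lemma transpose_H_matrix:
  assumes "transpose M = M"
  shows "transpose (H_matrix U M) = H_matrix U M"
proof -
  have add: "transpose (A + B) = transpose A + transpose B" for A B :: "real^'n^'n"
    by (simp add: transpose_def vec_eq_iff)
  show ?thesis
    by (simp add: H_matrix_def add matrix_transpose_mul assms matrix_mul_assoc)
qed

theorem corollary10:
  fixes U :: "real^'d^'n" and M :: "real^'d^'d" and \<epsilon> :: real
    and l :: "nat \<Rightarrow> real^'n" and T :: nat
  assumes "1 \<le> CARD('d)" and "real CARD('d) \<le> ln (real CARD('n))"
    and "rank U = CARD('d)"
    and "positive_definite M"
    and "is_lowner_john_ellipsoid (sym_body U) {v. v \<bullet> (matrix_inv M *v v) \<le> 1}"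
    and "\<epsilon> > 0"
    and "T \<ge> 1"
    and "\<forall>t\<in>{1..T}. l t \<in> subspace_losses U + small_losses \<epsilon>"
  shows "regret
           (omd UNIV (regularizer (H_matrix U M) \<epsilon>)
              (sqrt (2 * (16 * real CARD('d) + \<epsilon>) / real T)) l)
           l T
         \<le> sqrt (2 * (16 * real CARD('d) + \<epsilon>) * real T)"
proof (rule regret_le)
  fix i :: 'n
  note M = \<open>positive_definite M\<close>
  note LJ = \<open>is_lowner_john_ellipsoid _ _\<close>
  define A where "A = H_matrix U M + \<epsilon> *\<^sub>R mat 1"
  have reg: "regularizer (H_matrix U M) \<epsilon> = (\<lambda>x. x \<bullet> (A *v x))"
    by (simp add: fun_eq_iff regularizer_def A_def matrix_vector_mult_add_rdistrib
        scaleR_matrix_vector_assoc[symmetric] inner_add_right power2_norm_eq_inner)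
  have Aq: "x \<bullet> (A *v x) = (1 + \<epsilon>) * (norm x)\<^sup>2
      + (transpose U *v x) \<bullet> (M *v (transpose U *v x))" for x
    by (simp only: reg[symmetric, THEN fun_cong] regularizer_def H_matrix_quadratic algebra_simps)
  have A: "positive_definite A"
    unfolding positive_definite_def
  proof (intro conjI allI impI)
    have "transpose (H_matrix U M) = H_matrix U M"
      using M by (simp add: transpose_H_matrix positive_definite_def)
    then show "transpose A = A"
      by (simp add: A_def transpose_def vec_eq_iff mat_def)
    fix x :: "real^'n" assume "x \<noteq> 0"
    then show "0 < x \<bullet> (A *v x)"
      unfolding Aq using \<open>\<epsilon> > 0\<close> positive_definite_nonneg[OF M, of "transpose U *v x"]
      by (intro add_pos_nonneg) (auto simp del: transpose_matrix_vector)
  qed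
  define C where "C = 16 * real CARD('d) + \<epsilon>"
  define \<eta> where "\<eta> = sqrt (2 * C / real T)"
  have C: "0 < C" using \<open>\<epsilon> > 0\<close> by (simp add: C_def add_nonneg_pos)
  \<comment> \<open>With dual terms summing to at most \<open>2 * T\<close>, the two parts of the
    bound balance: \<open>C + \<eta>\<^sup>2 * T / 2 = 2 * C\<close>.\<close>
  have \<eta>: "0 < \<eta>" "\<eta>\<^sup>2 * real T = 2 * C" using C \<open>T \<ge> 1\<close> by (auto simp: \<eta>_def)
  have radius: "axis i 1 \<bullet> (A *v axis i 1) \<le> C"
  proof -
    have "transpose U *v axis i 1 = U $ i"
      by (simp add: matrix_vector_mult_basis column_def transpose_def vec_eq_iff
          del: transpose_matrix_vector)
    moreover have "U $ i \<bullet> (M *v (U $ i)) \<le> real CARD('d)"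
    proof (rule lowner_john_width[OF M LJ])
      fix v assume "v \<in> sym_body U"
      then show "\<bar>U $ i \<bullet> v\<bar> \<le> 1"
        using component_le_infnorm_cart[of "U *v v" i]
        by (simp add: sym_body_def matrix_vector_mul_component)
    qed
    moreover have "1 \<le> real CARD('d)" using \<open>1 \<le> CARD('d)\<close> by simp
    moreover have "(norm (axis i 1 :: real^'n))\<^sup>2 = 1" by (simp add: norm_axis_1)
    \<comment> \<open>Here \<open>c\<close> stands for the dimension and \<open>a\<close> for the
      width of row \<open>i\<close>, so the diagonal entry of \<open>A\<close> is
      \<open>1 + \<epsilon> + a\<close>.\<close>
    moreover have "(1 + \<epsilon>) * 1 + a \<le> 16 * c + \<epsilon>" if "a \<le> c" "1 \<le> c" for a c :: real
      using that by simp
    ultimately show ?thesis unfolding Aq C_def by (simp only:)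
  qed
  have dual_norms: "(\<Sum>t=1..T. l t \<bullet> (matrix_inv A *v l t)) \<le> (\<Sum>t=1..T. 2)"
  proof (rule sum_mono)
    fix t assume "t \<in> {1..T}"
    with assms(8) obtain l1 l2 where l1: "l1 \<in> subspace_losses U"
      and l2: "l2 \<in> small_losses \<epsilon>" and "l t = l1 + l2"
      by (meson set_plus_elim)
    moreover obtain v where "l1 = U *v v" using l1 by (auto simp: subspace_losses_def)
    ultimately have v: "U *v v \<in> subspace_losses U" and lt: "l t = U *v v + l2" by auto
    \<comment> \<open>The quantity to bound is
      \<open>z \<bullet> (A *v z) = z \<bullet> l t\<close>. The two Fenchel inequalities below add
      up to \<open>2 * (z \<bullet> l t) \<le> z \<bullet> (A *v z) + 2\<close>.\<close>
    define z where "z = matrix_inv A *v l t"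
    have Az: "A *v z = l t"
      by (simp add: z_def matrix_vector_mul_assoc
          matrix_inv_inverse[OF positive_definite_invertible[OF A]])
    have "infnorm (U *v v) \<le> 1"
      using v by (auto simp: infnorm_cart subspace_losses_def intro!: cSup_least)
    then have "v \<bullet> (matrix_inv M *v v) \<le> 1"
      using LJ by (auto simp: is_lowner_john_ellipsoid_def sym_body_def)
    moreover have "z \<bullet> (U *v v) = (transpose U *v z) \<bullet> v" by (simp add: dot_lmul_matrix)
    ultimately have "2 * (z \<bullet> (U *v v)) \<le> (transpose U *v z) \<bullet> (M *v (transpose U *v z)) + 1"
      using quadratic_Fenchel_le[OF M, of "transpose U *v z" v] by linarith
    moreover have "2 * (z \<bullet> l2) \<le> (1 + \<epsilon>) * (norm z)\<^sup>2 + 1"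
    proof -
      \<comment> \<open>Fenchel's inequality for \<open>1 + \<epsilon>\<close> times the identity,
        by completing the square.\<close>
      have "0 \<le> (norm ((1 + \<epsilon>) *\<^sub>R z - l2))\<^sup>2" by simp
      also have "\<dots> = (1 + \<epsilon>) * ((1 + \<epsilon>) * (norm z)\<^sup>2 - 2 * (z \<bullet> l2)) + (norm l2)\<^sup>2"
        by (simp add: power2_norm_eq_inner inner_diff_left inner_diff_right inner_commute[of l2 z]
            algebra_simps)
      also have "(norm l2)\<^sup>2 \<le> 1 + \<epsilon>" using l2 by (simp add: small_losses_def)
      finally have "0 \<le> (1 + \<epsilon>) * ((1 + \<epsilon>) * (norm z)\<^sup>2 - 2 * (z \<bullet> l2) + 1)"
        by (simp add: algebra_simps)
      then show ?thesis using \<open>\<epsilon> > 0\<close> by (simp add: zero_le_mult_iff)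
    qed
    moreover have "z \<bullet> (A *v z) = z \<bullet> (U *v v) + z \<bullet> l2"
      by (simp add: Az lt inner_add_right)
    ultimately have "z \<bullet> (A *v z) \<le> 2" using Aq[of z] by linarith
    then show "l t \<bullet> (matrix_inv A *v l t) \<le> 2" by (metis Az z_def inner_commute)
  qed
  have "\<eta> * (\<Sum>t=1..T. (omd UNIV (\<lambda>x. x \<bullet> (A *v x)) \<eta> l t - axis i 1) \<bullet> l t)
      \<le> axis i 1 \<bullet> (A *v axis i 1)
        + \<eta>\<^sup>2 / 4 * (\<Sum>t=1..T. l t \<bullet> (matrix_inv A *v l t))"
    by (rule omd_quadratic_regret[OF A axis_in_prob_simplex])
  also have "\<dots> \<le> C + \<eta>\<^sup>2 / 4 * (\<Sum>t=1..T. 2)"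
    by (intro add_mono radius mult_left_mono dual_norms) simp
  also have "\<dots> = \<eta> * sqrt (2 * C * real T)"
  proof -
    have "\<eta> * sqrt (2 * C * real T) = sqrt ((2 * C)\<^sup>2)"
      unfolding \<eta>_def real_sqrt_mult[symmetric]
      using \<open>T \<ge> 1\<close> by (simp add: power2_eq_square)
    also have "\<dots> = 2 * C" using C by (simp only: real_sqrt_abs)
    finally show ?thesis using \<eta>(2) by (simp add: mult.commute)
  qed
  finally have "(\<Sum>t=1..T. (omd UNIV (\<lambda>x. x \<bullet> (A *v x)) \<eta> l t - axis i 1) \<bullet> l t)
      \<le> sqrt (2 * C * real T)"
    using \<eta>(1) by (simp only: mult_le_cancel_left_pos)
  then show "(\<Sum>t=1..T. (omd UNIV (regularizer (H_matrix U M) \<epsilon>)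
        (sqrt (2 * (16 * real CARD('d) + \<epsilon>) / real T)) l t - axis i 1) \<bullet> l t)
      \<le> sqrt (2 * (16 * real CARD('d) + \<epsilon>) * real T)"
    by (simp only: reg \<eta>_def C_def)
qed

end
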